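(* Let $E^{\mathrm{ce}},F^{\mathrm{ce}}$ be equivalence relations on $\omega$ extending $=^{\mathrm{ce}}$ such that $E^{\mathrm{ce}}<_{\mathrm{Learn}}F^{\mathrm{ce}}$. Then there is a family $\mathfrak{K}$ of nonempty c.e. sets such that $\mathfrak{K}$ is not $E^{\mathrm{ce}}$-learnable and all indices of sets in $\mathfrak{K}$ belong to a single $F^{\mathrm{ce}}$-equivalence class.
   Context: Fix a standard (acceptable) enumeration $(\varphi_e)_{e\in\omega}$ of the partial computable functions and let $W_e=\operatorname{dom}(\varphi_e)$. Write $e=^{\mathrm{ce}}e'$ iff $W_e=W_{e'}$. Equivalence relations on $\omega$ extending $=^{\mathrm{ce}}$ are arbitrary (no definability or effectivity is assumed). An enumeration of a set $A$ is a surjection $\mu:\omega\to A$; $\mu[s]$ denotes the finite string $\mu(0),\dots,\mu(s-1)$. A learner is an arbitrary function $\mathbf{M}:\omega^{<\omega}\to\omega$ (no effectivity is assumed). A family $\mathfrak{K}$ of nonempty c.e. sets is $E^{\mathrm{ce}}$-learnable if there is a learner $\mathbf{M}$ such that for every $e$ with $W_e\in\mathfrak{K}$ and every enumeration $\mu$ of $W_e$ there is $i\in\omega$ with $i\mathrel{E^{\mathrm{ce}}}e$ and $\mathbf{M}(\mu[s])=i$ for all sufficiently large $s$. $E^{\mathrm{ce}}\leq_{\mathrm{Learn}}F^{\mathrm{ce}}$ means that every $E^{\mathrm{ce}}$-learnable family of nonempty c.e. sets is also $F^{\mathrm{ce}}$-learnable; $E^{\mathrm{ce}}<_{\mathrm{Learn}}F^{\mathrm{ce}}$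 means $E^{\mathrm{ce}}\leq_{\mathrm{Learn}}F^{\mathrm{ce}}$ and $F^{\mathrm{ce}}\not\leq_{\mathrm{Learn}}E^{\mathrm{ce}}$. An index of a c.e. set $A$ is any $e$ with $W_e=A$. *)

theory Defs
  imports Main
begin

text \<open>
  Partial computable functions are those given by \<open>\<mu>\<close>-recursive terms. Terms carry no arity
  check: on an argument list of unsuitable length the result is \<^const>\<open>None\<close>, which
  yields no additional functions of a fixed arity.
\<close>

datatype recterm =
    Zero
  | Succ
  | Proj nat
  | Comp recterm "recterm list"
  | PrimRec recterm recterm
  | Mu recterm

fun reval :: "recterm \<Rightarrow> nat list \<Rightarrow> nat option" where
  "reval Zero xs = Some 0"
| "reval Succ xs = (case xs of [x] \<Rightarrow> Some (Suc x) | _ \<Rightarrow> None)"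
| "reval (Proj i) xs = (if i < length xs then Some (xs ! i) else None)"
| "reval (Comp p qs) xs =
     (if \<forall>q \<in> set qs. reval q xs \<noteq> None
      then reval p (map (\<lambda>q. the (reval q xs)) qs) else None)"
| "reval (PrimRec p q) xs =
     (case xs of
        [] \<Rightarrow> None
      | n # ys \<Rightarrow>
          rec_nat (reval p ys) (\<lambda>m r. Option.bind r (\<lambda>v. reval q (m # v # ys))) n)"
| "reval (Mu p) xs =
     (if \<exists>n. reval p (n # xs) = Some 0 \<and> (\<forall>m<n. reval p (m # xs) \<noteq> None)
      then Some (LEAST n. reval p (n # xs) = Some 0 \<and> (\<forall>m<n. reval p (m # xs) \<noteq> None))
      else None)"

definition partial_computable1 :: "(nat \<Rightarrow> nat option) \<Rightarrow> bool" where
  "partial_computable1 f \<longleftrightarrow> (\<exists>p. \<forall>x. f x = reval p [x])"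

definition partial_computable2 :: "(nat \<Rightarrow> nat \<Rightarrow> nat option) \<Rightarrow> bool" where
  "partial_computable2 f \<longleftrightarrow> (\<exists>p. \<forall>x y. f x y = reval p [x, y])"

definition total_computable :: "(nat \<Rightarrow> nat) \<Rightarrow> bool" where
  "total_computable h \<longleftrightarrow> partial_computable1 (\<lambda>x. Some (h x))"

text \<open>
  Acceptability in the sense of Rogers: an enumeration of exactly the unary partial computable
  functions that has a computable universal function and satisfies the s-m-n property.
\<close>

definition acceptable_enumeration :: "(nat \<Rightarrow> nat \<Rightarrow> nat option) \<Rightarrow> bool" where
  "acceptable_enumeration \<phi> \<longleftrightarrow>
     range \<phi> = {f. partial_computable1 f} \<and>
     partial_computable2 \<phi> \<and>
     (\<forall>\<psi>. partial_computable2 \<psi> \<longrightarrow>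
        (\<exists>h. total_computable h \<and> (\<forall>e x. \<phi> (h e) x = \<psi> e x)))"

definition W :: "(nat \<Rightarrow> nat \<Rightarrow> nat option) \<Rightarrow> nat \<Rightarrow> nat set" where
  "W \<phi> e = dom (\<phi> e)"

definition eq_ce :: "(nat \<Rightarrow> nat \<Rightarrow> nat option) \<Rightarrow> (nat \<times> nat) set" where
  "eq_ce \<phi> = {(e, e'). W \<phi> e = W \<phi> e'}"

definition nonempty_ce_family :: "(nat \<Rightarrow> nat \<Rightarrow> nat option) \<Rightarrow> nat set set \<Rightarrow> bool" where
  "nonempty_ce_family \<phi> K \<longleftrightarrow> (\<forall>A \<in> K. A \<noteq> {} \<and> A \<in> range (W \<phi>))"

definition enumerates :: "(nat \<Rightarrow> nat) \<Rightarrow> nat set \<Rightarrow> bool" where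
  "enumerates \<mu> A \<longleftrightarrow> range \<mu> = A"

definition initial_segment :: "(nat \<Rightarrow> nat) \<Rightarrow> nat \<Rightarrow> nat list" where
  "initial_segment \<mu> s = map \<mu> [0..<s]"

definition learnable ::
    "(nat \<Rightarrow> nat \<Rightarrow> nat option) \<Rightarrow> (nat \<times> nat) set \<Rightarrow> nat set set \<Rightarrow> bool" where
  "learnable \<phi> E K \<longleftrightarrow>
     (\<exists>M :: nat list \<Rightarrow> nat. \<forall>e. W \<phi> e \<in> K \<longrightarrow>
        (\<forall>\<mu>. enumerates \<mu> (W \<phi> e) \<longrightarrow>
           (\<exists>i. (i, e) \<in> E \<and> (\<exists>s0. \<forall>s\<ge>s0. M (initial_segment \<mu> s) = i))))"

definition learn_le ::
    "(nat \<Rightarrow> nat \<Rightarrow> nat option) \<Rightarrow> (nat \<times> nat) set \<Rightarrow> (nat \<times> nat) set \<Rightarrow> bool" where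
  "learn_le \<phi> E F \<longleftrightarrow>
     (\<forall>K. nonempty_ce_family \<phi> K \<longrightarrow> learnable \<phi> E K \<longrightarrow> learnable \<phi> F K)"

definition learn_less ::
    "(nat \<Rightarrow> nat \<Rightarrow> nat option) \<Rightarrow> (nat \<times> nat) set \<Rightarrow> (nat \<times> nat) set \<Rightarrow> bool" where
  "learn_less \<phi> E F \<longleftrightarrow> learn_le \<phi> E F \<and> \<not> learn_le \<phi> F E"

end

theory Submission
  imports Defs "HOL-Library.Sublist"
begin

text \<open>
  Since learners need not be effective, learnability is governed by an Angluin-style tell-tale
  criterion: a family is \<open>R\<close>-learnable iff every member \<open>A\<close> has a finite subset \<open>D\<close> such that
  all members between \<open>D\<close> and \<open>A\<close> are \<open>R\<close>-equivalent to \<open>A\<close>. If \<open>K\<close> is \<open>F\<close>-learnable but not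
  \<open>E\<close>-learnable, some \<open>A\<close> in \<open>K\<close> has an \<open>F\<close>-tell-tale \<open>D\<close> but no \<open>E\<close>-tell-tale. The members of
  \<open>K\<close> between \<open>D\<close> and \<open>A\<close> all have \<open>F\<close>-equivalent indices, while \<open>A\<close> still has no \<open>E\<close>-tell-tale
  among them, because any finite subset of \<open>A\<close> can be enlarged by \<open>D\<close>.
\<close>

definition telltale ::
    "(nat \<Rightarrow> nat \<Rightarrow> nat option) \<Rightarrow> (nat \<times> nat) set \<Rightarrow> nat set set \<Rightarrow> nat \<Rightarrow> nat set \<Rightarrow> bool" where
  "telltale \<phi> R K a D \<longleftrightarrow> finite D \<and> D \<subseteq> W \<phi> a \<and>
     (\<forall>e. W \<phi> e \<in> K \<longrightarrow> D \<subseteq> W \<phi> e \<longrightarrow> W \<phi> e \<subseteq> W \<phi> a \<longrightarrow> (e, a) \<in> R)"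

lemma set_initial_segment: "set (initial_segment \<mu> s) = \<mu> ` {..<s}"
  by (auto simp: initial_segment_def)

lemma initial_segment_eqI:
  assumes "\<And>k. k < length xs \<Longrightarrow> \<mu> k = xs ! k"
  shows "initial_segment \<mu> (length xs) = xs"
  by (rule nth_equalityI) (auto simp: initial_segment_def assms)

lemma initial_segment_covers_finite:
  assumes "finite X" "X \<subseteq> range \<mu>"
  obtains s0 where "\<And>s. s \<ge> s0 \<Longrightarrow> X \<subseteq> set (initial_segment \<mu> s)"
proof -
  obtain N where N: "finite N" "X = \<mu> ` N"
    using assms finite_subset_image by metis
  show thesis
  proof
    fix s assume "s \<ge> Suc (Max N)"
    then have "N \<subseteq> {..<s}"
      using Max_ge[OF N(1)] by fastforce
    then show "X \<subseteq> set (initial_segment \<mu> s)"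
      using N(2) by (auto simp: set_initial_segment)
  qed
qed

lemma ex_enumeration_extending:
  assumes "set xs \<subseteq> A" "A \<noteq> {}"
  obtains \<mu> where "enumerates \<mu> A" "initial_segment \<mu> (length xs) = xs"
proof -
  obtain b where b: "b \<in> A" using assms(2) by auto
  \<comment> \<open>After \<open>xs\<close>, position \<open>length xs + x\<close> is reserved for
    \<open>x\<close>, so every element of \<open>A\<close> occurs; positions reserved for
    non-elements are filled with the default \<open>b\<close>.\<close>
  define \<mu> where "\<mu> n = (if n < length xs then xs ! n
      else if n - length xs \<in> A then n - length xs else b)" for n
  have "\<mu> n \<in> A" for n
    using assms(1) b by (auto simp: \<mu>_def)
  moreover have "x = \<mu> (length xs + x)" if "x \<in> A" for x
    using that by (simp add: \<mu>_def)
  ultimately have "range \<mu> = A"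
    by auto
  moreover have "initial_segment \<mu> (length xs) = xs"
    by (rule initial_segment_eqI) (simp add: \<mu>_def)
  ultimately show thesis
    using that by (auto simp: enumerates_def)
qed

text \<open>The length bound fixes entry \<open>k\<close> by stage \<open>Suc k\<close>, so the
  limit is total. Allowing any prefix \<open>xs\<close> of a stage also covers strings formed midway
  between two stages.\<close>

lemma prefix_chain_limit:
  assumes step: "\<And>n. prefix (\<sigma> n) (\<sigma> (Suc n))"
    and len: "\<And>n. n \<le> length (\<sigma> n)"
  obtains \<mu> :: "nat \<Rightarrow> nat"
    where "\<And>n xs. prefix xs (\<sigma> n) \<Longrightarrow> initial_segment \<mu> (length xs) = xs"
      and "range \<mu> = (\<Union>n. set (\<sigma> n))"
proof -
  define \<mu> where "\<mu> k = \<sigma> (Suc k) ! k" for k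
  have mono: "prefix (\<sigma> m) (\<sigma> n)" if "m \<le> n" for m n
    using that by (induction n rule: dec_induct) (auto intro: step prefix_order.trans)
  have nth: "\<mu> k = \<sigma> n ! k" if "k < length (\<sigma> n)" for k n
    using mono[of n "Suc k"] mono[of "Suc k" n] that len[of "Suc k"]
    by (cases "n \<le> Suc k") (auto simp: \<mu>_def prefix_def nth_append)
  show thesis
  proof
    fix n xs assume "prefix xs (\<sigma> n)"
    then show "initial_segment \<mu> (length xs) = xs"
      by (intro initial_segment_eqI)
        (metis nth nth_append order.strict_trans2 prefixE prefix_length_le)
  next
    show "range \<mu> = (\<Union>n. set (\<sigma> n))"
    proof (intro equalityI subsetI)
      fix x assume "x \<in> range \<mu>"
      then obtain k where "x = \<sigma> (Suc k) ! k" by (auto simp: \<mu>_def)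
      moreover have "k < length (\<sigma> (Suc k))" using len[of "Suc k"] by simp
      ultimately show "x \<in> (\<Union>n. set (\<sigma> n))" by (metis UN_I UNIV_I nth_mem)
    next
      fix x assume "x \<in> (\<Union>n. set (\<sigma> n))"
      then obtain n k where "k < length (\<sigma> n)" "x = \<sigma> n ! k" by (auto simp: in_set_conv_nth)
      then show "x \<in> range \<mu>" using nth by (metis rangeI)
    qed
  qed
qed

text \<open>The Blum-Blum argument: without a locking sequence, every string over \<open>A\<close>
  extends within \<open>A\<close> to one on which \<open>M\<close> changes its guess. Iterating this
  while listing \<open>A\<close> gives an enumeration of \<open>A\<close> on which \<open>M\<close>
  diverges.\<close>

lemma ex_locking_sequence:
  fixes M :: "nat list \<Rightarrow> nat"
  assumes "A \<noteq> {}"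
    and conv: "\<And>\<mu>. enumerates \<mu> A \<Longrightarrow> \<exists>i s0. \<forall>s\<ge>s0. M (initial_segment \<mu> s) = i"
  obtains \<sigma> where "set \<sigma> \<subseteq> A" "\<And>\<tau>. set \<tau> \<subseteq> A \<Longrightarrow> M (\<sigma> @ \<tau>) = M \<sigma>"
proof (rule ccontr)
  assume "\<not> thesis"
  then have "\<forall>\<sigma>. \<exists>\<tau>. set \<sigma> \<subseteq> A \<longrightarrow> set \<tau> \<subseteq> A \<and> M (\<sigma> @ \<tau>) \<noteq> M \<sigma>"
    using that by blast
  then obtain T where T: "\<And>\<sigma>. set \<sigma> \<subseteq> A \<Longrightarrow> set (T \<sigma>) \<subseteq> A \<and> M (\<sigma> @ T \<sigma>) \<noteq> M \<sigma>"
    by metis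
  have "set [] \<subseteq> A" by simp
  then obtain \<nu> where "enumerates \<nu> A"
    using assms(1) by (rule ex_enumeration_extending)
  then have \<nu>: "range \<nu> = A"
    by (simp add: enumerates_def)
  \<comment> \<open>Each stage first appends \<open>\<nu> n\<close>, so that the limit exhausts
    \<open>A\<close>, and then forces a change of guess.\<close>
  define \<sigma> where "\<sigma> = rec_nat [] (\<lambda>n xs. (xs @ [\<nu> n]) @ T (xs @ [\<nu> n]))"
  have \<sigma>_0: "\<sigma> 0 = []" and \<sigma>_Suc: "\<sigma> (Suc n) = (\<sigma> n @ [\<nu> n]) @ T (\<sigma> n @ [\<nu> n])" for n
    by (simp_all add: \<sigma>_def)
  have sub: "set (\<sigma> n) \<subseteq> A" for n
  proof (induction n)
    case (Suc n)
    then have "set (\<sigma> n @ [\<nu> n]) \<subseteq> A" using \<nu> by auto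
    then show ?case using T unfolding \<sigma>_Suc by (metis Un_least set_append)
  qed (simp add: \<sigma>_0)
  have len: "n \<le> length (\<sigma> n)" for n
    by (induction n) (auto simp: \<sigma>_Suc)
  have "prefix (\<sigma> n) (\<sigma> (Suc n))" for n
    by (simp add: \<sigma>_Suc)
  then obtain \<mu> where seg: "\<And>n xs. prefix xs (\<sigma> n) \<Longrightarrow> initial_segment \<mu> (length xs) = xs"
    and ran: "range \<mu> = (\<Union>n. set (\<sigma> n))"
    using prefix_chain_limit[of \<sigma>] len by blast
  have "\<nu> n \<in> set (\<sigma> (Suc n))" for n
    by (simp add: \<sigma>_Suc)
  then have "enumerates \<mu> A"
    unfolding enumerates_def ran using sub \<nu> by blast
  then obtain i s0 where lim: "\<And>s. s \<ge> s0 \<Longrightarrow> M (initial_segment \<mu> s) = i"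
    using conv by blast
  \<comment> \<open>Both \<open>?xs\<close> and \<open>?xs @ T ?xs\<close> are initial segments of
    \<open>\<mu>\<close> of length at least \<open>s0\<close>, yet \<open>T\<close> makes
    \<open>M\<close> differ on them.\<close>
  let ?xs = "\<sigma> s0 @ [\<nu> s0]"
  have "M ?xs = i"
    using seg[of ?xs "Suc s0"] lim[of "length ?xs"] len[of s0] by (simp add: \<sigma>_Suc)
  moreover have "M (?xs @ T ?xs) = i"
    using seg[of "\<sigma> (Suc s0)" "Suc s0"] lim[of "length (\<sigma> (Suc s0))"] len[of "Suc s0"]
    by (simp add: \<sigma>_Suc)
  moreover have "set ?xs \<subseteq> A"
    using sub[of s0] \<nu> by auto
  ultimately show False
    using T by metis
qed

text \<open>The content of a locking sequence \<open>\<sigma>\<close> for \<open>W \<phi> a\<close>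
  is a tell-tale: a member between it and \<open>W \<phi> a\<close> has an enumeration starting with
  \<open>\<sigma>\<close>, along which the guess stays \<open>M \<sigma>\<close>.\<close>

lemma learnable_imp_telltale:
  assumes R: "equiv UNIV R" and K: "nonempty_ce_family \<phi> K"
    and "learnable \<phi> R K" and a: "W \<phi> a \<in> K"
  shows "\<exists>D. telltale \<phi> R K a D"
proof -
  obtain M where M: "\<And>e \<mu>. W \<phi> e \<in> K \<Longrightarrow> enumerates \<mu> (W \<phi> e) \<Longrightarrow>
      \<exists>i. (i, e) \<in> R \<and> (\<exists>s0. \<forall>s\<ge>s0. M (initial_segment \<mu> s) = i)"
    using assms(3) unfolding learnable_def by metis
  have ne: "W \<phi> e \<noteq> {}" if "W \<phi> e \<in> K" for e
    using K that by (auto simp: nonempty_ce_family_def)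
  obtain \<sigma> where \<sigma>: "set \<sigma> \<subseteq> W \<phi> a"
    and lock: "\<And>\<tau>. set \<tau> \<subseteq> W \<phi> a \<Longrightarrow> M (\<sigma> @ \<tau>) = M \<sigma>"
    using ex_locking_sequence[OF ne[OF a], of M] M[OF a] by metis
  have guess: "(M \<sigma>, e) \<in> R"
    if e: "W \<phi> e \<in> K" "set \<sigma> \<subseteq> W \<phi> e" "W \<phi> e \<subseteq> W \<phi> a" for e
  proof -
    obtain \<mu> where \<mu>: "enumerates \<mu> (W \<phi> e)" "initial_segment \<mu> (length \<sigma>) = \<sigma>"
      using ex_enumeration_extending[OF e(2) ne[OF e(1)]] by blast
    obtain i s0 where i: "(i, e) \<in> R" and lim: "\<And>s. s \<ge> s0 \<Longrightarrow> M (initial_segment \<mu> s) = i"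
      using M[OF e(1) \<mu>(1)] by blast
    \<comment> \<open>Reading \<open>s0\<close> further values reaches a stage where
      \<open>M\<close> has converged while still being locked.\<close>
    define \<tau> where "\<tau> = map \<mu> [length \<sigma>..<length \<sigma> + s0]"
    have "initial_segment \<mu> (length \<sigma> + s0) = \<sigma> @ \<tau>"
      using \<mu>(2) upt_add_eq_append[of 0 "length \<sigma>" s0]
      by (simp add: initial_segment_def \<tau>_def)
    moreover have "set \<tau> \<subseteq> W \<phi> a"
      using \<mu>(1) e(3) by (auto simp: \<tau>_def enumerates_def)
    ultimately have "M \<sigma> = i"
      using lock lim[of "length \<sigma> + s0"] by simp
    then show ?thesis using i by simp
  qed
  \<comment> \<open>Taking \<open>a\<close> itself as the member relates \<open>M \<sigma>\<close>
    to \<open>a\<close>; symmetry and transitivity then relate \<open>e\<close> to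
    \<open>a\<close>.\<close>
  have "telltale \<phi> R K a (set \<sigma>)"
    unfolding telltale_def using \<sigma> guess guess[OF a \<sigma>] R
    by (metis List.finite_set equivE order.refl symD transD)
  then show ?thesis ..
qed

text \<open>The learner guesses the least index in the family that is consistent with the data and
  whose tell-tale has already appeared.\<close>

lemma telltale_imp_learnable:
  assumes R: "equiv UNIV R"
    and "\<And>a. W \<phi> a \<in> K \<Longrightarrow> \<exists>D. telltale \<phi> R K a D"
  shows "learnable \<phi> R K"
proof -
  obtain D where D: "\<And>a. W \<phi> a \<in> K \<Longrightarrow> telltale \<phi> R K a (D a)"
    using assms(2) by metis
  define P where "P X j \<longleftrightarrow> W \<phi> j \<in> K \<and> D j \<subseteq> X \<and> X \<subseteq> W \<phi> j" for X j
  define M where "M \<sigma> = (LEAST j. P (set \<sigma>) j)" for \<sigma>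
  have "\<exists>i. (i, e) \<in> R \<and> (\<exists>s0. \<forall>s\<ge>s0. M (initial_segment \<mu> s) = i)"
    if e: "W \<phi> e \<in> K" and \<mu>: "enumerates \<mu> (W \<phi> e)" for e \<mu>
  proof -
    let ?A = "W \<phi> e"
    \<comment> \<open>The limit guess. It may index a proper superset of \<open>?A\<close>, but
      \<open>D i \<subseteq> ?A \<subseteq> W \<phi> i\<close>, so the tell-tale of \<open>i\<close>
      makes it equivalent to \<open>e\<close>.\<close>
    define i where "i = (LEAST j. P ?A j)"
    have "P ?A e" using D[OF e] e by (auto simp: P_def telltale_def)
    then have Pi: "P ?A i" unfolding i_def by (rule LeastI)
    then have "(e, i) \<in> R"
      using D[of i] e by (simp add: P_def telltale_def)
    then have "(i, e) \<in> R"
      using R by (metis equivE symD)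
    have "\<forall>j. \<exists>x. \<not> ?A \<subseteq> W \<phi> j \<longrightarrow> x \<in> ?A - W \<phi> j" by auto
    then obtain x where x: "\<And>j. \<not> ?A \<subseteq> W \<phi> j \<Longrightarrow> x j \<in> ?A - W \<phi> j" by metis
    \<comment> \<open>Finite data that settles the guess: the tell-tale of \<open>i\<close>, and for
      each smaller \<open>j\<close> not covering \<open>?A\<close> an element refuting it.\<close>
    define X where "X = D i \<union> x ` {j. j < i \<and> \<not> ?A \<subseteq> W \<phi> j}"
    have "finite X" "X \<subseteq> range \<mu>"
      using Pi D[of i] x \<mu> by (auto simp: X_def P_def telltale_def enumerates_def)
    then obtain s0 where s0: "\<And>s. s \<ge> s0 \<Longrightarrow> X \<subseteq> set (initial_segment \<mu> s)"
      by (rule initial_segment_covers_finite) blast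
    have "M (initial_segment \<mu> s) = i" if "s \<ge> s0" for s
      unfolding M_def
    proof (rule Least_equality)
      let ?S = "set (initial_segment \<mu> s)"
      have SA: "?S \<subseteq> ?A" using \<mu> by (auto simp: set_initial_segment enumerates_def)
      show "P ?S i"
        using Pi SA s0[OF that] by (auto simp: P_def X_def)
      fix j assume j: "P ?S j"
      show "i \<le> j"
      proof (rule ccontr)
        assume "\<not> i \<le> j"
        then have "j < i" by simp
        then have "?A \<subseteq> W \<phi> j"
          using x[of j] s0[OF that] j by (auto simp: P_def X_def)
        \<comment> \<open>A smaller \<open>j\<close> that survives covers \<open>?A\<close>, and
          \<open>D j \<subseteq> ?S \<subseteq> ?A\<close>, against the minimality of
          \<open>i\<close>.\<close>
        then have "P ?A j" using j SA by (auto simp: P_def)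
        then show False using \<open>j < i\<close> not_less_Least unfolding i_def by blast
      qed
    qed
    then show ?thesis using \<open>(i, e) \<in> R\<close> by blast
  qed
  then show ?thesis unfolding learnable_def by blast
qed

theorem theorem3p7:
  fixes \<phi> :: "nat \<Rightarrow> nat \<Rightarrow> nat option"
    and E F :: "(nat \<times> nat) set"
  assumes "acceptable_enumeration \<phi>"
    and "equiv UNIV E" and "eq_ce \<phi> \<subseteq> E"
    and "equiv UNIV F" and "eq_ce \<phi> \<subseteq> F"
    and "learn_less \<phi> E F"
  shows "\<exists>K. nonempty_ce_family \<phi> K \<and> \<not> learnable \<phi> E K \<and>
           (\<exists>C \<in> UNIV // F. {e. W \<phi> e \<in> K} \<subseteq> C)"
proof -
  obtain K where K: "nonempty_ce_family \<phi> K" "learnable \<phi> F K" "\<not> learnable \<phi> E K"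
    using assms(6) by (auto simp: learn_less_def learn_le_def)
  obtain a where a: "W \<phi> a \<in> K" and no_E: "\<And>D. \<not> telltale \<phi> E K a D"
    using telltale_imp_learnable[OF assms(2), of \<phi> K] K(3) by metis
  obtain D where D: "telltale \<phi> F K a D"
    using learnable_imp_telltale[OF assms(4) K(1,2) a] ..
  define K' where "K' = {B \<in> K. D \<subseteq> B \<and> B \<subseteq> W \<phi> a}"
  have K': "nonempty_ce_family \<phi> K'"
    using K(1) by (auto simp: nonempty_ce_family_def K'_def)
  have a': "W \<phi> a \<in> K'"
    using a D by (auto simp: K'_def telltale_def)
  \<comment> \<open>A member of \<open>K\<close> between \<open>D \<union> D'\<close> and
    \<open>W \<phi> a\<close> contains \<open>D\<close>, hence lies in \<open>K'\<close>, where
    \<open>D'\<close> applies.\<close>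
  have "telltale \<phi> E K a (D \<union> D')" if "telltale \<phi> E K' a D'" for D'
    using that D by (auto simp: K'_def telltale_def)
  then have "\<not> learnable \<phi> E K'"
    using learnable_imp_telltale[OF assms(2) K' _ a'] no_E by metis
  moreover have "{e. W \<phi> e \<in> K'} \<subseteq> F `` {a}"
  proof
    fix e assume "e \<in> {e. W \<phi> e \<in> K'}"
    then have "(e, a) \<in> F" using D by (simp add: K'_def telltale_def)
    then show "e \<in> F `` {a}" using assms(4) by (metis Image_singleton_iff equivE symD)
  qed
  moreover have "F `` {a} \<in> UNIV // F"
    by (simp add: quotientI)
  ultimately show ?thesis
    using K' by blast
qed

end
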